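(* Let $d\ge2$ and $\alpha\in(0,1)$. With the notation of the context, $$\nu(\mathbb{B}(0,n),n,s)\prec\nu(\mathbb{B}(0,n),n,t)\qquad\text{whenever }-\infty<s\le t<\infty\text{ and }n\in\mathbb{Z}_+ .$$
   Context: $\mathbb{B}$ is the regular rooted $d$-ary tree with root $0$; $|x|$ is the distance of $x$ from the root, $\mathbb{B}(n)=\{x:|x|=n\}$, $\mathbb{B}(0,n)=\{x:|x|\le n\}$; $y\le x$ means $y$ is an ancestor of $x$ or $y=x$. $\{U_x:x\in\mathbb{B}\}$ are i.i.d. exponential random variables with mean $1$, $T(x)=\sum_{y\le x}\alpha^{|y|}U_y$, and $T(n)=\inf\{T(x):x\in\mathbb{B}(n)\}$. For $\Gamma\subset\mathbb{B}$ finite, $n\in\mathbb{Z}_+$ and $t\in\mathbb{R}$, $\nu(\Gamma,n,t)$ is the probability on $\mathbb{R}^\Gamma$ given by $$\nu(\Gamma,n,t)(\cdot)=P\bigl((t-T(x):x\in\Gamma)\in\cdot\mid T(n)>t\bigr)$$ (for $t\le0$ the conditioning is trivial). For probability laws $\mu,\nu$ on $\mathbb{R}^\Gamma$ with the coordinatewise partial order, $\mu\prec\nu$ ($\mu$ is stochastically smaller than $\nu$) means $\int\psi\,d\mu\le\int\psi\,d\nu$ for every bounded measurable non-decreasing $\psi$. *)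

theory Defs
  imports "HOL-Probability.Probability" "HOL-Library.Sublist"
begin

text \<open>
  A vertex of the regular rooted \<open>d\<close>-ary tree is the word of child indices (below \<open>d\<close>) along the
  path from the root to it. The root is \<open>[]\<close>, the distance \<open>|x|\<close> from the root is \<open>length x\<close>, and
  the relation ``\<open>y\<close> is an ancestor of \<open>x\<close> or \<open>y = x\<close>'' is \<open>prefix y x\<close>.
\<close>

definition tree :: "nat \<Rightarrow> nat list set" where
  "tree d = lists {..<d}"

definition level :: "nat \<Rightarrow> nat \<Rightarrow> nat list set" where
  "level d n = {x \<in> tree d. length x = n}"

definition tree_ball :: "nat \<Rightarrow> nat \<Rightarrow> nat list set" where
  "tree_ball d n = {x \<in> tree d. length x \<le> n}"

definition vertex_time :: "real \<Rightarrow> (nat list \<Rightarrow> 'w \<Rightarrow> real) \<Rightarrow> nat list \<Rightarrow> 'w \<Rightarrow> real" where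
  "vertex_time \<alpha> U x \<omega> = (\<Sum>y | prefix y x. \<alpha> ^ length y * U y \<omega>)"

definition level_time ::
    "nat \<Rightarrow> real \<Rightarrow> (nat list \<Rightarrow> 'w \<Rightarrow> real) \<Rightarrow> nat \<Rightarrow> 'w \<Rightarrow> real" where
  "level_time d \<alpha> U n \<omega> = (INF x\<in>level d n. vertex_time \<alpha> U x \<omega>)"

text \<open>
  \<open>\<real>\<^sup>\<Gamma>\<close> with its product sigma-algebra is \<open>\<Pi>\<^sub>M x\<in>\<Gamma>. borel\<close>, whose points are the functions that are
  \<open>undefined\<close> outside \<open>\<Gamma>\<close>. The measure \<open>uniform_measure M A\<close> is the conditional probability
  \<open>M(\<cdot> | A)\<close>, that is, \<open>B \<mapsto> M (A \<inter> B) / M A\<close>.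
\<close>

definition cond_law ::
    "'w measure \<Rightarrow> nat \<Rightarrow> real \<Rightarrow> (nat list \<Rightarrow> 'w \<Rightarrow> real) \<Rightarrow> nat list set \<Rightarrow> nat \<Rightarrow> real
      \<Rightarrow> (nat list \<Rightarrow> real) measure" where
  "cond_law M d \<alpha> U \<Gamma> n t =
     distr (uniform_measure M {\<omega> \<in> space M. level_time d \<alpha> U n \<omega> > t})
       (\<Pi>\<^sub>M x\<in>\<Gamma>. borel) (\<lambda>\<omega>. \<lambda>x\<in>\<Gamma>. t - vertex_time \<alpha> U x \<omega>)"

definition real_law :: "'i set \<Rightarrow> ('i \<Rightarrow> real) measure \<Rightarrow> bool" where
  "real_law \<Gamma> \<mu> \<longleftrightarrow> prob_space \<mu> \<and> sets \<mu> = sets (\<Pi>\<^sub>M x\<in>\<Gamma>. borel)"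

text \<open>
  Stochastic order is a relation between probability laws. Making this part of the definition keeps
  the comparison from holding for a degenerate reason, for instance between zero measures, which is
  what conditioning on a null event would produce.
\<close>

definition stoch_le :: "'i set \<Rightarrow> ('i \<Rightarrow> real) measure \<Rightarrow> ('i \<Rightarrow> real) measure \<Rightarrow> bool" where
  "stoch_le \<Gamma> \<mu> \<nu> \<longleftrightarrow> real_law \<Gamma> \<mu> \<and> real_law \<Gamma> \<nu> \<and>
     (\<forall>\<psi> :: ('i \<Rightarrow> real) \<Rightarrow> real.
        \<psi> \<in> borel_measurable (\<Pi>\<^sub>M x\<in>\<Gamma>. borel) \<longrightarrow>
        bounded (\<psi> ` (\<Pi>\<^sub>E x\<in>\<Gamma>. UNIV)) \<longrightarrow>
        (\<forall>f\<in>\<Pi>\<^sub>E x\<in>\<Gamma>. UNIV. \<forall>g\<in>\<Pi>\<^sub>E x\<in>\<Gamma>. UNIV. (\<forall>x\<in>\<Gamma>. f x \<le> g x) \<longrightarrow> \<psi> f \<le> \<psi> g) \<longrightarrow>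
        (\<integral>f. \<psi> f \<partial>\<mu>) \<le> (\<integral>f. \<psi> f \<partial>\<nu>))"

end

theory Submission
  imports Defs
begin

text \<open>
  Put \<open>Z\<^sub>x = t - T(x)\<close>. Along the tree these variables form a Markov chain: given its parent's value,
  \<open>Z\<^sub>x\<close> is obtained by subtracting \<open>\<alpha>\<^bsup>|x|\<^esup>\<close> times an independent mean-one exponential, and the
  root starts the same way from the value \<open>t\<close>. The event \<open>T(n) > t\<close> says that \<open>Z\<^sub>x < 0\<close> for all \<open>x\<close>
  at distance \<open>n\<close>, so its indicator is a product \<open>\<Prod>\<^sub>x g\<^sub>x (Z\<^sub>x)\<close> of functions of single vertices.

  Such a weighted chain is stochastically increasing in \<open>t\<close> because each of its steps, weighted and
  normalised, is stochastically increasing in the parent's value. For one exponential step this is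
  the memoryless property: weighted by \<open>g\<close> and normalised, the step from \<open>y\<close> has a density
  proportional to \<open>e\<^bsup>z/a\<^esup> g(z)\<close> on \<open>z < y\<close>, and \<open>y\<close> enters only through the truncation
  (\<open>step_mean_ratio_mono\<close>).

  The steps are put together by removing vertices one at a time. Integrating out a vertex \<open>x\<close> without
  descendants replaces a test function by its weighted mean over \<open>Z\<^sub>x\<close> (\<open>peel\<close>) and multiplies the
  weight of the parent of \<open>x\<close> by the normalising constant, a function of the parent's value
  (\<open>integral_peel\<close>). The new test function is again bounded, measurable and non-decreasing
  (\<open>observable_peel\<close>), and the new weights satisfy the same conditions as the old ones. When only the
  root is left, the one-step inequality with the starting points \<open>s\<close> and \<open>t\<close> is the claim.
\<close>

section \<open>One exponential step\<close>

definition exp_law :: "real measure" where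
  "exp_law = density lborel (exponential_density 1)"

text \<open>
  The kernel of one step from a vertex to a child: the expectation of \<open>h (y - a E)\<close>, where \<open>E\<close> is
  exponential with mean \<open>1\<close>.
\<close>

definition step_mean :: "real \<Rightarrow> (real \<Rightarrow> real) \<Rightarrow> real \<Rightarrow> real" where
  "step_mean a h y = (\<integral>u. h (y - a * u) \<partial>exp_law)"

lemma space_exp_law [simp]: "space exp_law = UNIV"
  by (simp add: exp_law_def)

lemma sets_exp_law [simp, measurable_cong]: "sets exp_law = sets borel"
  by (simp add: exp_law_def)

lemma prob_space_exp_law: "prob_space exp_law"
  unfolding exp_law_def by (rule prob_space_exponential_density) simp

lemma exponential_density_1_measurable [measurable]:
  "exponential_density 1 \<in> borel_measurable borel"
  unfolding exponential_density_def[abs_def] by measurable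

lemma integrable_exp_law:
  fixes h :: "real \<Rightarrow> real"
  assumes "h \<in> borel_measurable borel" and "\<And>u. \<bar>h u\<bar> \<le> B"
  shows "integrable exp_law h"
proof -
  interpret prob_space exp_law by (rule prob_space_exp_law)
  show ?thesis
    by (rule integrable_const_bound[where B = B]) (use assms in auto)
qed

lemma integral_exp_law:
  assumes [measurable]: "(h :: real \<Rightarrow> real) \<in> borel_measurable borel"
  shows "(\<integral>u. h u \<partial>exp_law) = (\<integral>u. exponential_density 1 u * h u \<partial>lborel)"
  unfolding exp_law_def
  by (subst integral_real_density) (auto simp: exponential_density_nonneg)

text \<open>The memoryless property of the exponential law.\<close>

lemma integral_exp_law_tail:
  fixes h :: "real \<Rightarrow> real"
  assumes [measurable]: "h \<in> borel_measurable borel" and "0 \<le> c"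
  shows "(\<integral>u. indicator {c..} u * h u \<partial>exp_law) = exp (- c) * (\<integral>u. h (c + u) \<partial>exp_law)"
proof -
  have "(\<integral>u. indicator {c..} u * h u \<partial>exp_law)
      = (\<integral>u. exponential_density 1 u * (indicator {c..} u * h u) \<partial>lborel)"
    by (rule integral_exp_law) measurable
  also have "\<dots> = (\<integral>u. exponential_density 1 (c + u) * (indicator {c..} (c + u) * h (c + u)) \<partial>lborel)"
    by (subst lborel_integral_real_affine[where c = 1 and t = c]) auto
  also have "\<dots> = (\<integral>u. exp (- c) * (exponential_density 1 u * h (c + u)) \<partial>lborel)"
    by (rule Bochner_Integration.integral_cong)
       (use \<open>0 \<le> c\<close> in \<open>auto simp: exponential_density_def indicator_def exp_diff exp_minus field_simps\<close>)
  also have "\<dots> = exp (- c) * (\<integral>u. h (c + u) \<partial>exp_law)"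
    by (subst integral_exp_law) auto
  finally show ?thesis .
qed

text \<open>
  The first term collects the steps from \<open>y'\<close> that stop above \<open>y\<close>; conditioned on passing below
  \<open>y\<close>, the step from \<open>y'\<close> is a step from \<open>y\<close>.
\<close>

lemma step_mean_split:
  fixes h :: "real \<Rightarrow> real"
  assumes [measurable]: "h \<in> borel_measurable borel" and B: "\<And>v. \<bar>h v\<bar> \<le> B"
    and "0 < a" and "y \<le> y'"
  shows "step_mean a h y' =
    (\<integral>u. indicator {..<(y' - y) / a} u * h (y' - a * u) \<partial>exp_law)
      + exp (- ((y' - y) / a)) * step_mean a h y"
proof -
  define c where "c = (y' - y) / a"
  have c: "0 \<le> c" "a * c = y' - y"
    using assms by (auto simp: c_def)
  have B0: "0 \<le> B"
    using B[of 0] by linarith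
  have int: "integrable exp_law (\<lambda>u. indicator A u * h (y' - a * u))"
    if [measurable]: "A \<in> sets borel" for A
    by (rule integrable_exp_law[where B = B]) (use B B0 in \<open>auto simp: indicator_def\<close>)
  have "step_mean a h y' = (\<integral>u. indicator {..<c} u * h (y' - a * u)
      + indicator {c..} u * h (y' - a * u) \<partial>exp_law)"
    unfolding step_mean_def
    by (rule Bochner_Integration.integral_cong) (auto simp: indicator_def)
  also have "\<dots> = (\<integral>u. indicator {..<c} u * h (y' - a * u) \<partial>exp_law)
      + (\<integral>u. indicator {c..} u * h (y' - a * u) \<partial>exp_law)"
    by (intro Bochner_Integration.integral_add int) auto
  also have "(\<integral>u. indicator {c..} u * h (y' - a * u) \<partial>exp_law)
      = exp (- c) * (\<integral>u. h (y' - a * (c + u)) \<partial>exp_law)"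
    by (rule integral_exp_law_tail) (use c in auto)
  also have "(\<lambda>u. h (y' - a * (c + u))) = (\<lambda>u. h (y - a * u))"
  proof
    fix u
    have "y' - a * (c + u) = y - a * u"
      using c(2) by (simp add: distrib_left)
    then show "h (y' - a * (c + u)) = h (y - a * u)"
      by simp
  qed
  finally show ?thesis
    by (simp add: step_mean_def c_def)
qed

lemma step_mean_measurable [measurable]:
  fixes h :: "real \<Rightarrow> real"
  assumes [measurable]: "h \<in> borel_measurable borel"
  shows "step_mean a h \<in> borel_measurable borel"
proof -
  interpret prob_space exp_law by (rule prob_space_exp_law)
  show ?thesis
    unfolding step_mean_def[abs_def] by measurable
qed

text \<open>A step only moves downwards, so it suffices to compare the functions on \<open>v \<le> y\<close>.\<close>

lemma step_mean_mono:
  fixes h k :: "real \<Rightarrow> real"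
  assumes [measurable]: "h \<in> borel_measurable borel" "k \<in> borel_measurable borel"
    and "\<And>v. \<bar>h v\<bar> \<le> B" "\<And>v. \<bar>k v\<bar> \<le> C" "\<And>v. v \<le> y \<Longrightarrow> h v \<le> k v" and "0 < a"
  shows "step_mean a h y \<le> step_mean a k y"
proof -
  have "AE u in exp_law. 0 \<le> u"
    unfolding exp_law_def
    by (subst AE_density) (auto simp: exponential_density_def)
  moreover have "0 \<le> u \<Longrightarrow> h (y - a * u) \<le> k (y - a * u)" for u
    using assms by (intro assms) auto
  ultimately have "AE u in exp_law. h (y - a * u) \<le> k (y - a * u)"
    by auto
  then show ?thesis
    unfolding step_mean_def
    by (intro integral_mono_AE integrable_exp_law[where B = B] integrable_exp_law[where B = C])
       (use assms in auto)
qed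

lemma step_mean_const: "step_mean a (\<lambda>_. c) y = c"
proof -
  interpret prob_space exp_law by (rule prob_space_exp_law)
  show ?thesis
    using prob_space by (simp add: step_mean_def)
qed

lemma step_mean_cmult: "step_mean a (\<lambda>v. c * h v) y = c * step_mean a h y"
  by (simp add: step_mean_def)

lemma step_mean_pos:
  fixes g :: "real \<Rightarrow> real"
  assumes [measurable]: "g \<in> borel_measurable borel" and g: "\<And>v. 0 \<le> g v" "\<And>v. g v \<le> 1"
    and pos: "\<And>v. v < 0 \<Longrightarrow> 0 < g v" and "0 < a"
  shows "0 < step_mean a g y"
proof -
  have int: "integrable exp_law (\<lambda>u. g (y - a * u))"
    by (rule integrable_exp_law[where B = 1]) (use g in auto)
  have "step_mean a g y \<noteq> 0"
  proof
    assume "step_mean a g y = 0"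
    then have "AE u in exp_law. g (y - a * u) = 0"
      unfolding step_mean_def
      by (subst (asm) integral_nonneg_eq_0_iff_AE[OF int]) (use g in auto)
    then have ae: "AE u in lborel. 0 < exponential_density 1 u \<longrightarrow> g (y - a * u) = 0"
      unfolding exp_law_def by (subst (asm) AE_density) auto
    define m where "m = max 0 (y / a)"
    have "AE u in lborel. u \<notin> {m<..<m + 1}"
      using ae
    proof eventually_elim
      case (elim u)
      show ?case
      proof
        assume "u \<in> {m<..<m + 1}"
        then have u: "0 < u" "y / a < u"
          by (auto simp: m_def)
        then have "y - a * u < 0"
          using \<open>0 < a\<close> by (simp add: field_simps)
        from pos[OF this] elim u show False
          by (auto simp: exponential_density_def)
      qed
    qed
    then have "emeasure lborel {m<..<m + 1} = 0"
      by (subst (asm) AE_iff_measurable[where N = "{m<..<m + 1}"]) auto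
    then show False
      by simp
  qed
  moreover have "0 \<le> step_mean a g y"
    unfolding step_mean_def by (rule integral_nonneg_AE) (use g in auto)
  ultimately show ?thesis
    by simp
qed

lemma step_mean_le_one:
  fixes g :: "real \<Rightarrow> real"
  assumes "g \<in> borel_measurable borel" and "\<And>v. 0 \<le> g v" "\<And>v. g v \<le> 1" and "0 < a"
  shows "step_mean a g y \<le> 1"
proof -
  have "step_mean a g y \<le> step_mean a (\<lambda>_. 1) y"
    by (rule step_mean_mono[where B = 1 and C = 1]) (use assms in auto)
  then show ?thesis
    by (simp add: step_mean_const)
qed

text \<open>
  Conditioning one step on survival with probability \<open>g\<close> keeps it stochastically increasing in the
  starting point: by \<open>step_mean_split\<close> the step from \<open>y'\<close> either stops above \<open>y\<close>, where \<open>h\<close> is at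
  least \<open>h y\<close>, or is distributed as a step from \<open>y\<close>, where \<open>h\<close> is at most \<open>h y\<close>. So the former
  steps only raise the weighted mean of \<open>h\<close>.
\<close>

lemma step_mean_ratio_mono:
  fixes g h :: "real \<Rightarrow> real"
  assumes [measurable]: "g \<in> borel_measurable borel" "h \<in> borel_measurable borel"
    and g: "\<And>v. 0 \<le> g v" "\<And>v. g v \<le> 1" and pos: "\<And>v. v < 0 \<Longrightarrow> 0 < g v"
    and B: "\<And>v. \<bar>h v\<bar> \<le> B" and "mono h" and "0 < a" and "y \<le> y'"
  shows "step_mean a (\<lambda>v. h v * g v) y / step_mean a g y
       \<le> step_mean a (\<lambda>v. h v * g v) y' / step_mean a g y'"
proof -
  define c where "c = (y' - y) / a"
  have B0: "0 \<le> B"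
    using B[of 0] by linarith
  have gB: "\<bar>h v * g v\<bar> \<le> B" "\<bar>g v\<bar> \<le> 1" for v
    using B[of v] g[of v] B0 mult_mono[of "\<bar>h v\<bar>" B "g v" 1] by (auto simp: abs_mult)
  define K where "K = step_mean a g y"
  define N where "N = step_mean a (\<lambda>v. h v * g v) y"
  define A where "A = (\<integral>u. indicator {..<c} u * (h (y' - a * u) * g (y' - a * u)) \<partial>exp_law)"
  define D where "D = (\<integral>u. indicator {..<c} u * g (y' - a * u) \<partial>exp_law)"
  define e where "e = exp (- c)"
  have K': "step_mean a g y' = D + e * K"
    unfolding D_def e_def K_def c_def
    by (rule step_mean_split) (use gB \<open>0 < a\<close> \<open>y \<le> y'\<close> in auto)
  have N': "step_mean a (\<lambda>v. h v * g v) y' = A + e * N"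
    unfolding A_def e_def N_def c_def
    by (rule step_mean_split[where h = "\<lambda>v. h v * g v"]) (use gB \<open>0 < a\<close> \<open>y \<le> y'\<close> in auto)
  have pK: "0 < K" "0 < step_mean a g y'"
    unfolding K_def by (intro step_mean_pos; use g pos \<open>0 < a\<close> in auto)+
  have D0: "0 \<le> D"
    unfolding D_def by (rule integral_nonneg_AE) (use g in \<open>auto simp: indicator_def\<close>)
  have NK: "N \<le> h y * K"
  proof -
    have "N \<le> step_mean a (\<lambda>v. h y * g v) y"
      unfolding N_def
      by (rule step_mean_mono[where B = B and C = "\<bar>h y\<bar>"])
         (use gB g \<open>0 < a\<close> \<open>mono h\<close> in \<open>auto simp: abs_mult mult_left_le intro!: mult_right_mono dest: monoD\<close>)
    then show ?thesis
      by (simp add: step_mean_cmult K_def)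
  qed
  have AD: "h y * D \<le> A"
  proof -
    have "(\<integral>u. h y * (indicator {..<c} u * g (y' - a * u)) \<partial>exp_law) \<le> A"
      unfolding A_def
    proof (rule integral_mono)
      show "integrable exp_law (\<lambda>u. h y * (indicator {..<c} u * g (y' - a * u)))"
        by (intro integrable_mult_right integrable_exp_law[where B = 1])
           (use g in \<open>auto simp: indicator_def\<close>)
      show "integrable exp_law (\<lambda>u. indicator {..<c} u * (h (y' - a * u) * g (y' - a * u)))"
        by (rule integrable_exp_law[where B = B]) (use gB B0 in \<open>auto simp: indicator_def\<close>)
      fix u :: real
      have "h y \<le> h (y' - a * u)" if "u < c"
        using that \<open>0 < a\<close> by (intro monoD[OF \<open>mono h\<close>]) (simp add: c_def field_simps)
      then show "h y * (indicator {..<c} u * g (y' - a * u))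
          \<le> indicator {..<c} u * (h (y' - a * u) * g (y' - a * u))"
        using g[of "y' - a * u"] by (auto simp: indicator_def intro: mult_right_mono)
    qed
    then show ?thesis
      by (simp add: D_def)
  qed
  have "N * D \<le> h y * K * D"
    by (rule mult_right_mono[OF NK D0])
  also have "\<dots> = (h y * D) * K"
    by simp
  also have "\<dots> \<le> A * K"
    by (rule mult_right_mono[OF AD]) (use pK in simp)
  finally have "N * (D + e * K) \<le> (A + e * N) * K"
    by (simp add: algebra_simps)
  then have "N / K \<le> (A + e * N) / (D + e * K)"
    using pK by (simp only: K' pos_divide_le_eq pos_le_divide_eq times_divide_eq_left)
  then show ?thesis
    unfolding K' N' N_def K_def .
qed

section \<open>Removing a maximal vertex\<close>

text \<open>
  The value \<open>t - T(x)\<close>, as a function of the deterministic times \<open>w y\<close> attached to the vertices.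
\<close>

definition position :: "real \<Rightarrow> real \<Rightarrow> (nat list \<Rightarrow> real) \<Rightarrow> nat list \<Rightarrow> real" where
  "position \<alpha> t w x = t - (\<Sum>y | prefix y x. \<alpha> ^ length y * w y)"

text \<open>Sets of vertices that contain all ancestors of their elements.\<close>

definition prefix_closed :: "'a list set \<Rightarrow> bool" where
  "prefix_closed S \<longleftrightarrow> (\<forall>x\<in>S. \<forall>y. prefix y x \<longrightarrow> y \<in> S)"

definition weight :: "'i set \<Rightarrow> ('i \<Rightarrow> real \<Rightarrow> real) \<Rightarrow> ('i \<Rightarrow> real) \<Rightarrow> real" where
  "weight S g z = (\<Prod>x\<in>S. g x (z x))"

text \<open>
  A survival function gives the probability of surviving at the value \<open>v\<close>. Positivity below \<open>0\<close> makes
  every step survive with positive probability, since an exponential step from any starting point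
  reaches the negative half-line.
\<close>

definition survival_fun :: "(real \<Rightarrow> real) \<Rightarrow> bool" where
  "survival_fun g \<longleftrightarrow> g \<in> borel_measurable borel \<and> (\<forall>v. 0 \<le> g v \<and> g v \<le> 1) \<and> (\<forall>v<0. 0 < g v)"

text \<open>
  The test functions of the stochastic order on \<open>\<real>\<^sup>S\<close>. They are taken on all functions \<open>'i \<Rightarrow> real\<close>;
  monotonicity with respect to the coordinates in \<open>S\<close> forces them to ignore the other coordinates
  (\<open>observable_cong\<close>), so no restriction to extensional functions is needed.
\<close>

definition observable :: "'i set \<Rightarrow> (('i \<Rightarrow> real) \<Rightarrow> real) \<Rightarrow> bool" where
  "observable S \<psi> \<longleftrightarrow> \<psi> \<in> borel_measurable (\<Pi>\<^sub>M x\<in>S. borel) \<and> (\<exists>B. \<forall>f. \<bar>\<psi> f\<bar> \<le> B) \<and>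
     (\<forall>f g. (\<forall>x\<in>S. f x \<le> g x) \<longrightarrow> \<psi> f \<le> \<psi> g)"

text \<open>
  The conditional mean of \<open>\<psi>\<close>, given the coordinates other than \<open>x\<close>, when \<open>z x\<close> is a step of mean
  length \<open>a\<close> from \<open>z p\<close> weighted by \<open>g\<close>.
\<close>

definition peel :: "real \<Rightarrow> (real \<Rightarrow> real) \<Rightarrow> 'i \<Rightarrow> 'i \<Rightarrow> (('i \<Rightarrow> real) \<Rightarrow> real) \<Rightarrow> ('i \<Rightarrow> real) \<Rightarrow> real" where
  "peel a g x p \<psi> z = step_mean a (\<lambda>v. \<psi> (z(x := v)) * g v) (z p) / step_mean a g (z p)"

lemma finite_prefixes [simp]: "finite {y. prefix y x}"
  by (simp flip: set_prefixes_eq)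

lemma position_Nil [simp]: "position \<alpha> t w [] = t - w []"
  by (simp add: position_def)

lemma position_upd_other:
  assumes "\<not> prefix x y"
  shows "position \<alpha> t (w(x := u)) y = position \<alpha> t w y"
proof -
  have "(\<Sum>z | prefix z y. \<alpha> ^ length z * (w(x := u)) z) = (\<Sum>z | prefix z y. \<alpha> ^ length z * w z)"
    by (rule sum.cong) (use assms in auto)
  then show ?thesis
    by (simp add: position_def)
qed

lemma position_upd_same:
  assumes "x \<noteq> []"
  shows "position \<alpha> t (w(x := u)) x = position \<alpha> t w (butlast x) - \<alpha> ^ length x * u"
proof -
  obtain xs i where x: "x = xs @ [i]"
    using assms by (cases x rule: rev_cases) auto
  have eq: "{y. prefix y x} = insert x {y. prefix y xs}"
    by (auto simp: x)
  have notin: "x \<notin> {y. prefix y xs}"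
    by (auto simp: x dest: prefix_length_le)
  have "(\<Sum>z | prefix z x. \<alpha> ^ length z * (w(x := u)) z)
      = \<alpha> ^ length x * u + (\<Sum>z | prefix z xs. \<alpha> ^ length z * (w(x := u)) z)"
    unfolding eq using notin by (subst sum.insert) auto
  also have "(\<Sum>z | prefix z xs. \<alpha> ^ length z * (w(x := u)) z)
      = (\<Sum>z | prefix z xs. \<alpha> ^ length z * w z)"
    by (rule sum.cong) (use notin in auto)
  finally show ?thesis
    by (simp add: position_def x)
qed

lemma observable_cong:
  assumes "observable S \<psi>" and "\<And>x. x \<in> S \<Longrightarrow> f x = g x"
  shows "\<psi> f = \<psi> g"
  using assms unfolding observable_def by (metis order.antisym order.refl)

lemma position_measurable:
  assumes "prefix_closed S" and "x \<in> S"
  shows "(\<lambda>w. position \<alpha> t w x) \<in> borel_measurable (\<Pi>\<^sub>M x\<in>S. borel)"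
  unfolding position_def
proof (intro borel_measurable_diff borel_measurable_const borel_measurable_sum borel_measurable_times)
  fix y assume "y \<in> {y. prefix y x}"
  then have "y \<in> S"
    using assms by (auto simp: prefix_closed_def)
  then show "(\<lambda>w. w y) \<in> borel_measurable (\<Pi>\<^sub>M x\<in>S. borel)"
    by (rule measurable_component_singleton)
qed

lemma restrict_position_measurable:
  assumes "prefix_closed S"
  shows "(\<lambda>w. \<lambda>x\<in>S. position \<alpha> t w x) \<in> (\<Pi>\<^sub>M x\<in>S. borel) \<rightarrow>\<^sub>M (\<Pi>\<^sub>M x\<in>S. borel)"
  by (intro measurable_restrict position_measurable assms)

lemma observable_position_measurable:
  assumes "observable S \<psi>" and "prefix_closed S"
  shows "(\<lambda>w. \<psi> (position \<alpha> t w)) \<in> borel_measurable (\<Pi>\<^sub>M x\<in>S. borel)"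
proof -
  have "(\<lambda>w. \<psi> (\<lambda>x\<in>S. position \<alpha> t w x)) \<in> borel_measurable (\<Pi>\<^sub>M x\<in>S. borel)"
    by (rule measurable_compose[OF restrict_position_measurable[OF assms(2)]])
       (use assms(1) in \<open>simp add: observable_def\<close>)
  moreover have "(\<lambda>w. \<psi> (\<lambda>x\<in>S. position \<alpha> t w x)) = (\<lambda>w. \<psi> (position \<alpha> t w))"
    by (intro ext observable_cong[OF assms(1)]) simp
  ultimately show ?thesis
    by simp
qed

lemma weight_position_measurable:
  assumes "\<And>x. survival_fun (g x)" and "prefix_closed S"
  shows "(\<lambda>w. weight S g (position \<alpha> t w)) \<in> borel_measurable (\<Pi>\<^sub>M x\<in>S. borel)"
  unfolding weight_def
  by (intro borel_measurable_prod measurable_compose[OF position_measurable[OF assms(2)]])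
     (use assms(1) in \<open>auto simp: survival_fun_def\<close>)

lemma weight_bounds:
  assumes "\<And>x. survival_fun (g x)"
  shows "0 \<le> weight S g z" "weight S g z \<le> 1"
  unfolding weight_def using assms
  by (auto simp: survival_fun_def intro: prod_nonneg prod_le_1)

lemma sets_PiM_exp_law: "sets (\<Pi>\<^sub>M x\<in>S. exp_law) = sets (\<Pi>\<^sub>M x\<in>S. borel)"
  by (intro sets_PiM_cong) auto

lemma integrable_PiM_exp_law:
  fixes h :: "('i \<Rightarrow> real) \<Rightarrow> real"
  assumes "h \<in> borel_measurable (\<Pi>\<^sub>M x\<in>S. borel)" and "\<And>w. \<bar>h w\<bar> \<le> B"
  shows "integrable (\<Pi>\<^sub>M x\<in>S. exp_law) h"
proof -
  interpret prob_space "\<Pi>\<^sub>M x\<in>S. exp_law"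
    by (intro prob_space_PiM prob_space_exp_law)
  have "h \<in> borel_measurable (\<Pi>\<^sub>M x\<in>S. exp_law)"
    using assms(1) by (simp cong: measurable_cong_sets add: sets_PiM_exp_law)
  then show ?thesis
    by (intro integrable_const_bound[where B = B]) (use assms in auto)
qed

lemma observable_slice:
  assumes "observable (insert x S) \<psi>"
  shows "(\<lambda>v. \<psi> (z(x := v))) \<in> borel_measurable borel" "mono (\<lambda>v. \<psi> (z(x := v)))"
proof -
  have "(\<lambda>v. (restrict z S)(x := v)) \<in> borel \<rightarrow>\<^sub>M (\<Pi>\<^sub>M x\<in>insert x S. borel)"
    by (rule measurable_fun_upd[where J = S]) (auto simp: space_PiM)
  then have "(\<lambda>v. \<psi> ((restrict z S)(x := v))) \<in> borel_measurable borel"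
    by (rule measurable_compose) (use assms in \<open>simp add: observable_def\<close>)
  moreover have "(\<lambda>v. \<psi> ((restrict z S)(x := v))) = (\<lambda>v. \<psi> (z(x := v)))"
    by (intro ext observable_cong[OF assms]) auto
  ultimately show "(\<lambda>v. \<psi> (z(x := v))) \<in> borel_measurable borel"
    by simp
  show "mono (\<lambda>v. \<psi> (z(x := v)))"
    using assms by (auto simp: observable_def intro!: monoI)
qed

lemma survival_funD:
  assumes "survival_fun g"
  shows "g \<in> borel_measurable borel" "0 \<le> g v" "g v \<le> 1" "v < 0 \<Longrightarrow> 0 < g v"
  using assms by (auto simp: survival_fun_def)

lemma survival_fun_times_step_mean:
  assumes "survival_fun g" "survival_fun h" and "0 < a"
  shows "survival_fun (\<lambda>v. g v * step_mean a h v)"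
proof -
  have [measurable]: "g \<in> borel_measurable borel" "h \<in> borel_measurable borel"
    using assms by (simp_all add: survival_fun_def)
  have "0 < step_mean a h v" "step_mean a h v \<le> 1" for v
    using step_mean_pos[of h a v] step_mean_le_one[of h a v] survival_funD[OF assms(2)] \<open>0 < a\<close> by auto
  then show ?thesis
    using survival_funD[OF assms(1)]
    by (auto simp: survival_fun_def less_imp_le intro!: mult_le_one)
qed

text \<open>
  Raising \<open>z\<close> raises \<open>peel a g x p \<psi> z\<close> in two ways: through the coordinates of \<open>\<psi>\<close> in \<open>S\<close>, with the law of
  the step unchanged, and then through the starting point \<open>z p\<close> of the step.
\<close>

lemma observable_peel:
  assumes obs: "observable (insert x S) \<psi>" and "x \<notin> S" and "p \<in> S"
    and g: "survival_fun g" and "0 < a"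
  shows "observable S (peel a g x p \<psi>)"
proof -
  note gD = survival_funD[OF g]
  have [measurable]: "g \<in> borel_measurable borel" and
    \<psi>_meas [measurable]: "\<psi> \<in> borel_measurable (\<Pi>\<^sub>M x\<in>insert x S. borel)"
    using g obs by (simp_all add: survival_fun_def observable_def)
  obtain B where B: "\<And>f. \<bar>\<psi> f\<bar> \<le> B"
    using obs by (auto simp: observable_def)
  have B0: "0 \<le> B"
    using B[of undefined] by linarith
  have mono: "\<psi> f \<le> \<psi> f'" if "\<And>y. y \<in> insert x S \<Longrightarrow> f y \<le> f' y" for f f'
    using obs that by (auto simp: observable_def)
  have gB: "\<bar>\<psi> f * g v\<bar> \<le> B" for f v
    using B[of f] gD(2,3)[of v] B0 mult_mono[of "\<bar>\<psi> f\<bar>" B "g v" 1] by (auto simp: abs_mult)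
  have K: "0 < step_mean a g v" for v
    using gD \<open>0 < a\<close> by (intro step_mean_pos) auto
  note slice = observable_slice[OF obs]
  have slice_g [measurable]: "(\<lambda>v. \<psi> (z(x := v)) * g v) \<in> borel_measurable borel" for z
    by (intro borel_measurable_times slice(1)) auto
  have meas: "peel a g x p \<psi> \<in> borel_measurable (\<Pi>\<^sub>M x\<in>S. borel)"
  proof -
    interpret prob_space exp_law by (rule prob_space_exp_law)
    have [measurable]: "(\<lambda>z. z p) \<in> borel_measurable (\<Pi>\<^sub>M x\<in>S. borel)"
      using \<open>p \<in> S\<close> by (rule measurable_component_singleton)
    have [measurable]: "(\<lambda>w. (fst w)(x := fst w p - a * snd w))
        \<in> (\<Pi>\<^sub>M x\<in>S. borel) \<Otimes>\<^sub>M exp_law \<rightarrow>\<^sub>M (\<Pi>\<^sub>M x\<in>insert x S. borel)"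
      by (rule measurable_fun_upd[where J = S]) auto
    have "(\<lambda>z. \<integral>u. \<psi> (z(x := z p - a * u)) * g (z p - a * u) \<partial>exp_law)
        \<in> borel_measurable (\<Pi>\<^sub>M x\<in>S. borel)"
    proof (rule borel_measurable_lebesgue_integral)
      have "(\<lambda>w. \<psi> ((fst w)(x := fst w p - a * snd w)) * g (fst w p - a * snd w))
        \<in> borel_measurable ((\<Pi>\<^sub>M x\<in>S. borel) \<Otimes>\<^sub>M exp_law)"
        by measurable
      then show "(\<lambda>(z, u). \<psi> (z(x := z p - a * u)) * g (z p - a * u))
        \<in> borel_measurable ((\<Pi>\<^sub>M x\<in>S. borel) \<Otimes>\<^sub>M exp_law)"
        by (simp add: case_prod_beta')
    qed
    then show ?thesis
      unfolding peel_def[abs_def] step_mean_def[of a "\<lambda>v. \<psi> (_(x := v)) * g v"] by measurable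
  qed
  have bound: "\<bar>peel a g x p \<psi> z\<bar> \<le> B" for z
  proof -
    have "step_mean a (\<lambda>v. \<psi> (z(x := v)) * g v) (z p) \<le> step_mean a (\<lambda>v. B * g v) (z p)"
      by (rule step_mean_mono[where B = B and C = B])
         (use gB gD B B0 \<open>0 < a\<close> in \<open>auto simp: abs_mult mult_left_le abs_le_iff intro!: mult_right_mono\<close>)
    moreover have "step_mean a (\<lambda>v. - B * g v) (z p) \<le> step_mean a (\<lambda>v. \<psi> (z(x := v)) * g v) (z p)"
    proof (rule step_mean_mono[where B = B and C = B])
      fix v
      have "- B \<le> \<psi> (z(x := v))"
        using B[of "z(x := v)"] by linarith
      then show "- B * g v \<le> \<psi> (z(x := v)) * g v"
        using gD(2) by (rule mult_right_mono)
    qed (use gB gD B0 \<open>0 < a\<close> in \<open>auto simp: abs_mult mult_left_le\<close>)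
    ultimately show ?thesis
      using K[of "z p"] unfolding step_mean_cmult
      by (auto simp: peel_def abs_le_iff pos_divide_le_eq minus_divide_left)
  qed
  have incr: "peel a g x p \<psi> z \<le> peel a g x p \<psi> z'" if le: "\<And>y. y \<in> S \<Longrightarrow> z y \<le> z' y" for z z'
  proof -
    have "peel a g x p \<psi> z \<le> step_mean a (\<lambda>v. \<psi> (z'(x := v)) * g v) (z p) / step_mean a g (z p)"
      unfolding peel_def
      by (intro divide_right_mono step_mean_mono[where B = B and C = B] mult_right_mono mono)
         (use gB gD K le \<open>0 < a\<close> in \<open>auto simp: less_imp_le\<close>)
    also have "\<dots> \<le> peel a g x p \<psi> z'"
      unfolding peel_def
      by (rule step_mean_ratio_mono[where B = B]) (use gD B slice le \<open>p \<in> S\<close> \<open>0 < a\<close> in auto)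
    finally show ?thesis .
  qed
  show ?thesis
    unfolding observable_def using meas bound incr by blast
qed

text \<open>
  Fubini's theorem for a vertex \<open>x\<close> of \<open>insert x S\<close> without descendants. The normalising constant
  that \<open>peel\<close> divides by is moved into the weight of the parent.
\<close>

lemma integral_peel:
  assumes obs: "observable (insert x S) \<psi>" and fin: "finite S" and "x \<notin> S" "x \<noteq> []"
    and p: "butlast x \<in> S"
    and cl: "prefix_closed (insert x S)" and mx: "\<And>y. y \<in> S \<Longrightarrow> \<not> prefix x y"
    and g: "\<And>y. survival_fun (g y)" and "0 < \<alpha>"
  defines "a \<equiv> \<alpha> ^ length x" and "p \<equiv> butlast x"
  shows "(\<integral>w. \<psi> (position \<alpha> t w) * weight (insert x S) g (position \<alpha> t w) \<partial>(\<Pi>\<^sub>M y\<in>insert x S. exp_law))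
    = (\<integral>w. peel a (g x) x p \<psi> (position \<alpha> t w)
        * weight S (g(p := \<lambda>v. g p v * step_mean a (g x) v)) (position \<alpha> t w) \<partial>(\<Pi>\<^sub>M y\<in>S. exp_law))"
proof -
  interpret E: prob_space exp_law by (rule prob_space_exp_law)
  interpret product_sigma_finite "\<lambda>_. exp_law" by standard
  have a: "0 < a"
    using \<open>0 < \<alpha>\<close> by (simp add: a_def)
  obtain B where B: "\<And>f. \<bar>\<psi> f\<bar> \<le> B"
    using obs by (auto simp: observable_def)
  have B0: "0 \<le> B"
    using B[of undefined] by linarith
  have W: "0 \<le> weight A g z" "weight A g z \<le> 1" for A z
    using g by (rule weight_bounds)+
  have int: "integrable (\<Pi>\<^sub>M y\<in>insert x S. exp_law)
      (\<lambda>w. \<psi> (position \<alpha> t w) * weight (insert x S) g (position \<alpha> t w))"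
  proof (rule integrable_PiM_exp_law[where B = B])
    fix w
    show "\<bar>\<psi> (position \<alpha> t w) * weight (insert x S) g (position \<alpha> t w)\<bar> \<le> B"
      using B[of "position \<alpha> t w"] W[of "insert x S" "position \<alpha> t w"] B0
        mult_mono[of "\<bar>\<psi> (position \<alpha> t w)\<bar>" B "weight (insert x S) g (position \<alpha> t w)" 1]
      by (auto simp: abs_mult)
  qed (intro borel_measurable_times observable_position_measurable[OF obs cl]
      weight_position_measurable g cl)
  have inner: "(\<integral>u. \<psi> (position \<alpha> t (w(x := u))) * weight (insert x S) g (position \<alpha> t (w(x := u))) \<partial>exp_law)
    = peel a (g x) x p \<psi> (position \<alpha> t w)
        * weight S (g(p := \<lambda>v. g p v * step_mean a (g x) v)) (position \<alpha> t w)" for w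
  proof -
    define z where "z = position \<alpha> t w"
    have pos: "position \<alpha> t (w(x := u)) y = (z(x := z p - a * u)) y" if "y \<in> insert x S" for y u
      using that mx position_upd_other[where x = x and y = y] position_upd_same[OF \<open>x \<noteq> []\<close>]
      by (auto simp: z_def a_def p_def)
    have w1: "weight (insert x S) g (position \<alpha> t (w(x := u))) = g x (z p - a * u) * weight S g z" for u
    proof -
      have "weight (insert x S) g (position \<alpha> t (w(x := u)))
          = (\<Prod>y\<in>insert x S. g y ((z(x := z p - a * u)) y))"
        unfolding weight_def by (intro prod.cong refl) (simp only: pos)
      also have "\<dots> = g x (z p - a * u) * weight S g z"
        using fin \<open>x \<notin> S\<close> unfolding weight_def
        by (subst prod.insert) (auto intro!: prod.cong arg_cong2[where f = "(*)"])
      finally show ?thesis .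
    qed
    have w2: "weight S (g(p := \<lambda>v. g p v * step_mean a (g x) v)) z
        = step_mean a (g x) (z p) * weight S g z"
      using fin p unfolding weight_def p_def[symmetric]
      by (subst (1 2) prod.remove[where x = p]) (auto intro!: prod.cong)
    have \<psi>_eq: "\<psi> (position \<alpha> t (w(x := u))) = \<psi> (z(x := z p - a * u))" for u
      by (rule observable_cong[OF obs pos])
    have "(\<integral>u. \<psi> (position \<alpha> t (w(x := u))) * weight (insert x S) g (position \<alpha> t (w(x := u))) \<partial>exp_law)
      = (\<integral>u. weight S g z * (\<psi> (z(x := z p - a * u)) * g x (z p - a * u)) \<partial>exp_law)"
      unfolding w1 \<psi>_eq by (simp add: mult_ac)
    also have "\<dots> = weight S g z * step_mean a (\<lambda>v. \<psi> (z(x := v)) * g x v) (z p)"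
      by (simp add: step_mean_def)
    also have "\<dots> = peel a (g x) x p \<psi> z * (step_mean a (g x) (z p) * weight S g z)"
      using step_mean_pos[of "g x" a "z p"] survival_funD[OF g[of x]] a by (simp add: peel_def)
    finally show ?thesis
      unfolding w2[symmetric] unfolding z_def .
  qed
  show ?thesis
    by (subst product_integral_insert[OF fin \<open>x \<notin> S\<close> int]) (simp only: inner)
qed

section \<open>Monotonicity in the starting time\<close>

text \<open>
  With \<open>\<psi>\<close> the test function and \<open>g\<close> the survival functions, \<open>N r / W r\<close> is the mean of \<open>\<psi>\<close> under
  the weighted law of the chain started from \<open>r\<close>. The induction removes a vertex of maximal length.
\<close>

lemma conditioned_mean_mono:
  assumes "finite S" "prefix_closed S" "S \<noteq> {}" and "0 < \<alpha>" and "s \<le> t"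
    and "observable S \<psi>" and "\<And>x. survival_fun (g x)"
  defines "N \<equiv> \<lambda>r. \<integral>w. \<psi> (position \<alpha> r w) * weight S g (position \<alpha> r w) \<partial>(\<Pi>\<^sub>M x\<in>S. exp_law)"
    and "W \<equiv> \<lambda>r. \<integral>w. weight S g (position \<alpha> r w) \<partial>(\<Pi>\<^sub>M x\<in>S. exp_law)"
  shows "0 < W r \<and> N s / W s \<le> N t / W t"
  using assms(1-3,6,7) unfolding N_def W_def
proof (induction "card S" arbitrary: S \<psi> g rule: less_induct)
  case less
  note fin = less.prems(1) and cl = less.prems(2) and ne = less.prems(3)
    and obs = less.prems(4) and g = less.prems(5)
  interpret E: prob_space exp_law by (rule prob_space_exp_law)
  interpret product_sigma_finite "\<lambda>_. exp_law" by standard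
  obtain B where B: "\<And>f. \<bar>\<psi> f\<bar> \<le> B"
    using obs by (auto simp: observable_def)
  show ?case
  proof (cases "S = {[]}")
    case True
    note gD = survival_funD[OF g[of "[]"]]
    have [measurable]: "g [] \<in> borel_measurable borel"
      by (rule gD)
    have obs': "observable (insert [] {}) \<psi>"
      using obs True by simp
    note slice = observable_slice[OF obs']
    note [measurable] = slice(1)
    \<comment> \<open>The coordinates other than the root are irrelevant, so they may be set to \<open>0\<close>.\<close>
    have \<psi>_eq: "\<psi> (position \<alpha> r w) = \<psi> ((\<lambda>_. 0)([] := r - 1 * w []))" for r w
      by (rule observable_cong[OF obs]) (simp add: True)
    have w_eq: "weight S g (position \<alpha> r w) = g [] (r - 1 * w [])" for r w
      by (simp add: weight_def True)
    have N: "(\<integral>w. \<psi> (position \<alpha> r w) * weight S g (position \<alpha> r w) \<partial>(\<Pi>\<^sub>M x\<in>S. exp_law))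
        = step_mean 1 (\<lambda>v. \<psi> ((\<lambda>_. 0)([] := v)) * g [] v) r" for r
      unfolding \<psi>_eq w_eq step_mean_def unfolding True
      by (rule product_integral_singleton) measurable
    have W: "(\<integral>w. weight S g (position \<alpha> r w) \<partial>(\<Pi>\<^sub>M x\<in>S. exp_law)) = step_mean 1 (g []) r" for r
      unfolding w_eq step_mean_def unfolding True
      by (rule product_integral_singleton) measurable
    show ?thesis
      unfolding N W
    proof
      show "0 < step_mean 1 (g []) r"
        by (rule step_mean_pos) (use gD in auto)
      show "step_mean 1 (\<lambda>v. \<psi> ((\<lambda>_. 0)([] := v)) * g [] v) s / step_mean 1 (g []) s
          \<le> step_mean 1 (\<lambda>v. \<psi> ((\<lambda>_. 0)([] := v)) * g [] v) t / step_mean 1 (g []) t"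
        by (rule step_mean_ratio_mono[where B = B]) (use gD B slice \<open>s \<le> t\<close> in auto)
    qed
  next
    case False
    have "Max (length ` S) \<in> length ` S"
      using fin ne by (intro Max_in) auto
    then obtain x where x: "x \<in> S" and "length x = Max (length ` S)"
      by auto
    then have mx: "length y \<le> length x" if "y \<in> S" for y
      using fin that by simp
    have "x \<noteq> []"
      using False x mx by auto
    define S' where "S' = S - {x}"
    define p where "p = butlast x"
    define a where "a = \<alpha> ^ length x"
    define g' where "g' = g(p := \<lambda>v. g p v * step_mean a (g x) v)"
    have "prefix p x" "p \<noteq> x"
      using \<open>x \<noteq> []\<close> by (cases x rule: rev_cases; simp add: p_def)+
    then have p: "p \<in> S'"
      using cl x by (auto simp: S'_def prefix_closed_def)
    have S: "S = insert x S'" and "x \<notin> S'" and fin': "finite S'"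
      using x fin by (auto simp: S'_def)
    have nprefix: "\<not> prefix x y" if "y \<in> S'" for y
      using that mx[of y] by (auto simp: S'_def prefix_def)
    have cl': "prefix_closed S'"
      unfolding prefix_closed_def
    proof (intro ballI allI impI)
      fix y z assume "y \<in> S'" "prefix z y"
      then have "z \<in> S" "z \<noteq> x"
        using cl nprefix by (auto simp: S'_def prefix_closed_def)
      then show "z \<in> S'"
        by (simp add: S'_def)
    qed
    have card: "card S' < card S"
      unfolding S using fin' \<open>x \<notin> S'\<close> by simp
    have a: "0 < a"
      using \<open>0 < \<alpha>\<close> by (simp add: a_def)
    have g': "survival_fun (g' y)" for y
      using survival_fun_times_step_mean[OF g g a] g by (simp add: g'_def)
    have one: "observable S (\<lambda>_. 1)"
      by (auto simp: observable_def)
    have peel_one: "peel a (g x) x p (\<lambda>_. 1) z = 1" for z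
      using step_mean_pos[of "g x" a "z p"] survival_funD[OF g[of x]] a by (simp add: peel_def)
    have step: "(\<integral>w. \<phi> (position \<alpha> r w) * weight S g (position \<alpha> r w) \<partial>(\<Pi>\<^sub>M x\<in>S. exp_law))
      = (\<integral>w. peel a (g x) x p \<phi> (position \<alpha> r w) * weight S' g' (position \<alpha> r w) \<partial>(\<Pi>\<^sub>M x\<in>S'. exp_law))"
      if "observable S \<phi>" for \<phi> r
      using integral_peel[of x S' \<phi> g \<alpha> r] that fin' \<open>x \<notin> S'\<close> \<open>x \<noteq> []\<close> p cl nprefix g \<open>0 < \<alpha>\<close>
      by (simp add: S p_def a_def g'_def)
    \<comment> \<open>The normalising integral is the numerator for the constant test function \<open>1\<close>.\<close>
    have W: "(\<integral>w. weight S g (position \<alpha> r w) \<partial>(\<Pi>\<^sub>M x\<in>S. exp_law))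
      = (\<integral>w. weight S' g' (position \<alpha> r w) \<partial>(\<Pi>\<^sub>M x\<in>S'. exp_law))" for r
      using step[OF one, of r] by (simp add: peel_one)
    have "observable S' (peel a (g x) x p \<psi>)"
      by (rule observable_peel) (use obs \<open>x \<notin> S'\<close> p g a in \<open>auto simp: S\<close>)
    then show ?thesis
      unfolding step[OF obs] W
      by (intro less.hyps[OF card fin' cl']) (use p g' in auto)
  qed
qed

section \<open>The conditional law\<close>

lemma finite_tree_ball: "finite (tree_ball d n)"
proof -
  have "tree_ball d n = {x. set x \<subseteq> {..<d} \<and> length x \<le> n}"
    by (auto simp: tree_ball_def tree_def)
  then show ?thesis
    by (simp add: finite_lists_length_le)
qed

lemma prefix_closed_tree_ball: "prefix_closed (tree_ball d n)"
  by (auto simp: prefix_closed_def tree_ball_def tree_def prefix_def)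

lemma less_level_time_iff:
  assumes "0 < d"
  shows "t < level_time d \<alpha> U n w \<longleftrightarrow> (\<forall>x\<in>level d n. t < vertex_time \<alpha> U x w)"
proof -
  have "level d n \<subseteq> tree_ball d n"
    by (auto simp: level_def tree_ball_def)
  then have "finite (level d n)"
    using finite_tree_ball by (rule finite_subset)
  moreover have "replicate n 0 \<in> level d n"
    using assms by (auto simp: level_def tree_def)
  ultimately show ?thesis
    unfolding level_time_def by (subst finite_less_Inf_iff) auto
qed

lemma (in prob_space) integral_uniform_measure_eq:
  fixes f :: "'a \<Rightarrow> real"
  assumes [measurable]: "f \<in> borel_measurable M" "A \<in> events" and "0 < prob A"
  shows "(\<integral>x. f x \<partial>uniform_measure M A) = (\<integral>x. indicator A x * f x \<partial>M) / prob A"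
proof -
  have "uniform_measure M A = density M (\<lambda>x. ennreal (indicator A x / prob A))"
    unfolding uniform_measure_def
    using \<open>0 < prob A\<close> by (intro arg_cong[where f = "density M"] ext)
      (auto simp: emeasure_eq_measure divide_ennreal indicator_def ennreal_1[symmetric] simp del: ennreal_1)
  then have "(\<integral>x. f x \<partial>uniform_measure M A) = (\<integral>x. indicator A x / prob A * f x \<partial>M)"
    by (simp add: integral_real_density)
  then show ?thesis
    by simp
qed

text \<open>
  Survival functions whose product is the indicator of \<open>T(n) > t\<close>: the vertices at distance \<open>n\<close> must
  have a negative value, the others are unconstrained.
\<close>

definition leaf_survival :: "nat \<Rightarrow> nat list \<Rightarrow> real \<Rightarrow> real" where
  "leaf_survival n x v = (if length x = n then indicator {..<0} v else 1)"

lemma survival_fun_leaf_survival: "survival_fun (leaf_survival n x)"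
  unfolding leaf_survival_def[abs_def] by (cases "length x = n") (auto simp: survival_fun_def)

lemma weight_leaf_survival:
  "weight (tree_ball d n) (leaf_survival n) z = (if \<forall>x\<in>level d n. z x < 0 then 1 else 0)"
proof (cases "\<forall>x\<in>level d n. z x < 0")
  case True
  then have "leaf_survival n x (z x) = 1" if "x \<in> tree_ball d n" for x
    using that by (auto simp: leaf_survival_def level_def tree_ball_def)
  then show ?thesis
    using True by (simp add: weight_def)
next
  case False
  then obtain x where "x \<in> level d n" "\<not> z x < 0"
    by auto
  then have "x \<in> tree_ball d n" "leaf_survival n x (z x) = 0"
    by (auto simp: leaf_survival_def level_def tree_ball_def)
  then show ?thesis
    using False finite_tree_ball by (auto simp: weight_def)
qed

theorem lemma3p1:
  fixes M :: "'w measure" and U :: "nat list \<Rightarrow> 'w \<Rightarrow> real"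
    and d n :: nat and \<alpha> s t :: real
  assumes "prob_space M"
    and "d \<ge> 2" and "0 < \<alpha>" and "\<alpha> < 1"
    and "prob_space.indep_vars M (\<lambda>_. borel) U (tree d)"
    and "\<And>x. x \<in> tree d \<Longrightarrow> distributed M lborel (U x) (exponential_density 1)"
    and "s \<le> t"
  shows "stoch_le (tree_ball d n)
           (cond_law M d \<alpha> U (tree_ball d n) n s)
           (cond_law M d \<alpha> U (tree_ball d n) n t)"
proof -
  interpret prob_space M by fact
  define S where "S = tree_ball d n"
  define P where "P = (\<Pi>\<^sub>M x\<in>S. (borel :: real measure))"
  define X where "X = (\<lambda>w. \<lambda>x\<in>S. U x w)"
  define g where "g = leaf_survival n"
  define A where "A = (\<lambda>r. {w \<in> space M. level_time d \<alpha> U n w > r})"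
  define Y where "Y = (\<lambda>r w. \<lambda>x\<in>S. r - vertex_time \<alpha> U x w)"
  have fin: "finite S" and cl: "prefix_closed S"
    unfolding S_def by (rule finite_tree_ball prefix_closed_tree_ball)+
  have root: "[] \<in> S" and sub: "S \<subseteq> tree d"
    by (auto simp: S_def tree_ball_def tree_def)
  have g: "survival_fun (g x)" for x
    unfolding g_def by (rule survival_fun_leaf_survival)
  have U_meas: "U x \<in> borel_measurable M" if "x \<in> S" for x
    using distributed_measurable[OF assms(6)[of x]] that sub by auto
  have X [measurable]: "X \<in> M \<rightarrow>\<^sub>M P"
    unfolding X_def P_def by (intro measurable_restrict U_meas)
  have law: "distr M P X = (\<Pi>\<^sub>M x\<in>S. exp_law)"
  proof -
    have "indep_vars (\<lambda>_. borel) U S"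
      using assms(5) sub by (rule indep_vars_subset)
    then have "distr M P X = (\<Pi>\<^sub>M x\<in>S. distr M borel (U x))"
      unfolding P_def X_def
      by (subst (asm) indep_vars_iff_distr_eq_PiM') (use root U_meas in auto)
    also have "\<dots> = (\<Pi>\<^sub>M x\<in>S. exp_law)"
    proof (rule PiM_cong)
      fix x assume "x \<in> S"
      then have "distr M lborel (U x) = exp_law"
        using distributed_distr_eq_density[OF assms(6)[of x]] sub by (auto simp: exp_law_def)
      moreover have "distr M lborel (U x) = distr M borel (U x)"
        by (rule distr_cong) auto
      ultimately show "distr M borel (U x) = exp_law"
        by simp
    qed simp
    finally show ?thesis .
  qed
  have pos: "position \<alpha> r (X w) x = r - vertex_time \<alpha> U x w" if "x \<in> S" for r w x
  proof -
    have "(\<Sum>y | prefix y x. \<alpha> ^ length y * X w y) = vertex_time \<alpha> U x w"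
      unfolding vertex_time_def
      by (rule sum.cong) (use that cl in \<open>auto simp: X_def prefix_closed_def\<close>)
    then show ?thesis
      by (simp add: position_def)
  qed
  have Y [measurable]: "Y r \<in> M \<rightarrow>\<^sub>M P" for r
  proof -
    have "Y r = (\<lambda>w. \<lambda>x\<in>S. position \<alpha> r (X w) x)"
      unfolding Y_def using pos by (auto simp: fun_eq_iff restrict_def)
    then show ?thesis
      using measurable_compose[OF X[unfolded P_def] restrict_position_measurable[OF cl]]
      by (simp add: P_def)
  qed
  have weight_X: "weight S g (position \<alpha> r (X w)) = indicator (A r) w" if "w \<in> space M" for r w
  proof -
    have "(\<forall>x\<in>level d n. position \<alpha> r (X w) x < 0) \<longleftrightarrow> (\<forall>x\<in>level d n. r < vertex_time \<alpha> U x w)"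
      by (intro ball_cong refl, subst pos) (auto simp: S_def level_def tree_ball_def)
    also have "\<dots> \<longleftrightarrow> r < level_time d \<alpha> U n w"
      using assms(2) by (subst less_level_time_iff) auto
    finally show ?thesis
      using that unfolding S_def g_def weight_leaf_survival by (simp add: A_def indicator_def)
  qed
  have weight_meas: "(\<lambda>w. weight S g (position \<alpha> r w)) \<in> borel_measurable P" for r
    unfolding P_def by (rule weight_position_measurable[OF g cl])
  have A [measurable]: "A r \<in> events" for r
  proof -
    have "(\<lambda>w. weight S g (position \<alpha> r (X w))) \<in> borel_measurable M"
      by (rule measurable_compose[OF X weight_meas])
    then have "indicat_real (A r) \<in> borel_measurable M"
      by (subst (asm) measurable_cong[OF weight_X]) auto
    then show ?thesis
      by (subst (asm) borel_measurable_indicator_iff) (auto simp: A_def Int_def cong: conj_cong)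
  qed
  have prob_A: "prob (A r) = (\<integral>w. weight S g (position \<alpha> r w) \<partial>(\<Pi>\<^sub>M x\<in>S. exp_law))" for r
  proof -
    have "(\<integral>w. weight S g (position \<alpha> r w) \<partial>(\<Pi>\<^sub>M x\<in>S. exp_law))
        = (\<integral>w. weight S g (position \<alpha> r (X w)) \<partial>M)"
      unfolding law[symmetric] by (rule integral_distr[OF X weight_meas])
    also have "\<dots> = (\<integral>w. indicator (A r) w \<partial>M)"
      by (rule Bochner_Integration.integral_cong) (auto simp: weight_X)
    finally show ?thesis
      by simp
  qed
  have one: "observable S (\<lambda>_. 1)"
    by (auto simp: observable_def)
  have A_pos: "0 < prob (A r)" for r
    unfolding prob_A
    using conditioned_mean_mono[where g = g and r = r, OF fin cl _ \<open>0 < \<alpha>\<close> \<open>s \<le> t\<close> one g] root by blast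
  have law_eq: "cond_law M d \<alpha> U S n r = distr (uniform_measure M (A r)) P (Y r)" for r
    by (simp add: cond_law_def S_def P_def A_def Y_def)
  have real_law: "real_law S (distr (uniform_measure M (A r)) P (Y r))" for r
  proof -
    interpret A: prob_space "uniform_measure M (A r)"
      by (rule prob_space_uniform_measure) (use A_pos[of r] in \<open>auto simp: emeasure_eq_measure\<close>)
    have "Y r \<in> uniform_measure M (A r) \<rightarrow>\<^sub>M P"
      by measurable
    then show ?thesis
      unfolding real_law_def by (auto simp: P_def intro: A.prob_space_distr)
  qed
  show ?thesis
    unfolding stoch_le_def law_eq S_def[symmetric] P_def[symmetric]
  proof (intro conjI real_law allI impI)
    fix \<psi> :: "(nat list \<Rightarrow> real) \<Rightarrow> real"
    assume \<psi> [measurable]: "\<psi> \<in> borel_measurable P"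
      and bdd: "bounded (\<psi> ` (\<Pi>\<^sub>E x\<in>S. UNIV))"
      and mono: "\<forall>f\<in>\<Pi>\<^sub>E x\<in>S. UNIV. \<forall>g\<in>\<Pi>\<^sub>E x\<in>S. UNIV. (\<forall>x\<in>S. f x \<le> g x) \<longrightarrow> \<psi> f \<le> \<psi> g"
    \<comment> \<open>Outside the extensional functions nothing is known about \<open>\<psi>\<close>, so it is replaced by \<open>\<phi>\<close>,
      which agrees with it there.\<close>
    define \<phi> where "\<phi> = (\<lambda>f. \<psi> (restrict f S))"
    have obs: "observable S \<phi>"
      unfolding observable_def
    proof (intro conjI allI impI)
      have "(\<lambda>f. restrict f S) \<in> P \<rightarrow>\<^sub>M P"
        unfolding P_def by (rule measurable_restrict_subset) simp
      then show "\<phi> \<in> borel_measurable (\<Pi>\<^sub>M x\<in>S. borel)"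
        unfolding \<phi>_def P_def[symmetric] by measurable
      obtain B where "\<And>f. f \<in> (\<Pi>\<^sub>E x\<in>S. UNIV) \<Longrightarrow> \<bar>\<psi> f\<bar> \<le> B"
        using bdd by (auto simp: bounded_iff)
      then show "\<exists>B. \<forall>f. \<bar>\<phi> f\<bar> \<le> B"
        unfolding \<phi>_def by (intro exI[of _ B]) auto
      show "\<phi> f \<le> \<phi> h" if "\<forall>x\<in>S. f x \<le> h x" for f h
        unfolding \<phi>_def using that by (intro mono[rule_format]) auto
    qed
    have eq: "(\<integral>f. \<psi> f \<partial>distr (uniform_measure M (A r)) P (Y r))
      = (\<integral>w. \<phi> (position \<alpha> r w) * weight S g (position \<alpha> r w) \<partial>(\<Pi>\<^sub>M x\<in>S. exp_law))
        / (\<integral>w. weight S g (position \<alpha> r w) \<partial>(\<Pi>\<^sub>M x\<in>S. exp_law))" for r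
    proof -
      have \<phi>_X: "\<phi> (position \<alpha> r (X w)) = \<psi> (Y r w)" for w
        unfolding \<phi>_def Y_def by (intro arg_cong[where f = \<psi>]) (auto simp: pos restrict_def)
      have meas: "(\<lambda>w. \<phi> (position \<alpha> r w) * weight S g (position \<alpha> r w)) \<in> borel_measurable P"
        unfolding P_def by (intro borel_measurable_times observable_position_measurable[OF obs cl]
            weight_position_measurable g cl)
      have "(\<integral>f. \<psi> f \<partial>distr (uniform_measure M (A r)) P (Y r)) = (\<integral>w. \<psi> (Y r w) \<partial>uniform_measure M (A r))"
        by (rule integral_distr) measurable
      also have "\<dots> = (\<integral>w. indicator (A r) w * \<psi> (Y r w) \<partial>M) / prob (A r)"
        by (rule integral_uniform_measure_eq) (use A_pos in measurable)
      also have "(\<integral>w. indicator (A r) w * \<psi> (Y r w) \<partial>M)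
          = (\<integral>w. \<phi> (position \<alpha> r (X w)) * weight S g (position \<alpha> r (X w)) \<partial>M)"
        by (rule Bochner_Integration.integral_cong) (auto simp: weight_X \<phi>_X)
      also have "\<dots> = (\<integral>w. \<phi> (position \<alpha> r w) * weight S g (position \<alpha> r w) \<partial>(\<Pi>\<^sub>M x\<in>S. exp_law))"
        unfolding law[symmetric] by (rule integral_distr[OF X meas, symmetric])
      finally show ?thesis
        by (simp add: prob_A)
    qed
    show "(\<integral>f. \<psi> f \<partial>distr (uniform_measure M (A s)) P (Y s))
        \<le> (\<integral>f. \<psi> f \<partial>distr (uniform_measure M (A t)) P (Y t))"
      unfolding eq
      using conditioned_mean_mono[where g = g, OF fin cl _ \<open>0 < \<alpha>\<close> \<open>s \<le> t\<close> obs g] root by blast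
  qed
qed

end
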